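(* Let $V$ be a vector space with a gradation $V=\bigoplus_{n\ge 0}V_n$, let $N\in\mathbb{N}$ (with $0\in\mathbb N$) and let $f:V\to V$ be a linear endomorphism homogeneous of degree $N$ (that is, $f(V_n)\subseteq V_{n+N}$ for all $n$). For all $n\ge 0$ put $$T(V,f)_n=\bigoplus_{k\ge 0}\ \bigoplus_{i_1+\ldots+i_k=n-N}V_{i_1}\otimes\ldots\otimes V_{i_k},$$ where the term $k=0$ contributes $\mathbb{K}\emptyset$ if $n=N$ and $(0)$ otherwise. Then $(T(V,f)_n)_{n\ge 0}$ is a gradation of the pre-Lie algebra $T(V,f)$, that is, $T(V,f)=\bigoplus_{n\ge 0}T(V,f)_n$ and $T(V,f)_m\bullet T(V,f)_n\subseteq T(V,f)_{m+n}$ for all $m,n\ge 0$.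
   Context: $\mathbb{K}$ is a field of characteristic zero. For a vector space $V$, $T(V)=\bigoplus_{n\ge 0}V^{\otimes n}$ is spanned by words $x_1\ldots x_n$ with letters in $V$; $\emptyset$ is the empty word; juxtaposition denotes concatenation. The shuffle product $\sqcup\!\sqcup$ is the bilinear product with $\emptyset\sqcup\!\sqcup w=w\sqcup\!\sqcup\emptyset=w$ and $xu\sqcup\!\sqcup yv=x(u\sqcup\!\sqcup yv)+y(xu\sqcup\!\sqcup v)$ for $x,y\in V$, $u,v\in T(V)$. For a linear endomorphism $f$ of $V$, the bilinear product $\bullet$ on $T(V)$ is defined by induction on the length of words by $\emptyset\bullet w'=0$ and $(xw)\bullet w'=x(w\bullet w')+f(x)(w\sqcup\!\sqcup w')$ for $x\in V$, $w,w'\in T(V)$; it is a (right) pre-Lie product, and $T(V,f)$ denotes $T(V)$ with this product. *)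

theory Defs
  imports Complex_Main "HOL-Library.Function_Algebras"
begin

section \<open>Direct sum decompositions indexed by the natural numbers\<close>

definition direct_sum_decomposition ::
  "('k::field \<Rightarrow> 'a::ab_group_add \<Rightarrow> 'a) \<Rightarrow> 'a set \<Rightarrow> (nat \<Rightarrow> 'a set) \<Rightarrow> bool" where
  "direct_sum_decomposition s W A \<longleftrightarrow>
     module.subspace s W \<and>
     (\<forall>n. module.subspace s (A n) \<and> A n \<subseteq> W) \<and>
     (\<forall>v\<in>W. \<exists>!d. (\<forall>n. d n \<in> A n) \<and> finite {n. d n \<noteq> 0} \<and> v = (\<Sum>n | d n \<noteq> 0. d n))"

section \<open>The tensor algebra\<close>

text \<open>
  A vector space \<open>V\<close> over a field is given by its scalar multiplication \<open>s\<close>, the underlying set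
  being a type. A function on lists of vectors is the same as a family of functions on the
  powers \<open>V\<^sup>k\<close>, \<open>k \<ge> 0\<close>; it is called multilinear if each member of the family is.
\<close>

definition multilinear ::
  "('k::field \<Rightarrow> 'v::ab_group_add \<Rightarrow> 'v) \<Rightarrow> ('k \<Rightarrow> 'w::ab_group_add \<Rightarrow> 'w) \<Rightarrow> ('v list \<Rightarrow> 'w) \<Rightarrow> bool" where
  "multilinear s s' g \<longleftrightarrow>
     (\<forall>us x y vs. g (us @ (x + y) # vs) = g (us @ x # vs) + g (us @ y # vs)) \<and>
     (\<forall>us c x vs. g (us @ s c x # vs) = s' c (g (us @ x # vs)))"

text \<open>
  Over a field, \<open>V\<^sup>\<otimes>\<^sup>k\<close> embeds into the dual of the space of \<open>k\<close>-linear forms, the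
  tensor \<open>x\<^sub>1 \<dots> x\<^sub>k\<close> being evaluation at \<open>(x\<^sub>1, \<dots>, x\<^sub>k)\<close>. The tensor algebra is
  constructed as the span of these evaluations, where functionals are extended by \<open>0\<close> to
  arguments that are not multilinear. The theorem \<open>tensor_algebra_universal\<close> below shows
  that the result has the universal property of \<open>T(V)\<close>.
\<close>

type_synonym ('k, 'v) tensor = "('v list \<Rightarrow> 'k) \<Rightarrow> 'k"

definition word :: "('k::field \<Rightarrow> 'v::ab_group_add \<Rightarrow> 'v) \<Rightarrow> 'v list \<Rightarrow> ('k, 'v) tensor" where
  "word s xs = (\<lambda>B. if multilinear s (*) B then B xs else 0)"

definition tensor_scale :: "'k::field \<Rightarrow> ('k, 'v) tensor \<Rightarrow> ('k, 'v) tensor" where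
  "tensor_scale c t = (\<lambda>B. c * t B)"

definition tensor_algebra :: "('k::field \<Rightarrow> 'v::ab_group_add \<Rightarrow> 'v) \<Rightarrow> ('k, 'v) tensor set" where
  "tensor_algebra s = module.span tensor_scale (range (word s))"

definition tensor_power :: "('k::field \<Rightarrow> 'v::ab_group_add \<Rightarrow> 'v) \<Rightarrow> nat \<Rightarrow> ('k, 'v) tensor set" where
  "tensor_power s k = module.span tensor_scale (word s ` {xs. length xs = k})"

text \<open>
  The linear extension to \<open>T(V)\<close> of a multilinear function \<open>g\<close> defined on words with values in
  \<open>T(V)\<close>: if \<open>t = \<Sum>\<^sub>i c\<^sub>i w\<^sub>i\<close> then \<open>t (\<lambda>w. g w B) = \<Sum>\<^sub>i c\<^sub>i g w\<^sub>i B\<close> for all \<open>B\<close>.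
\<close>

definition linear_extension ::
  "('v list \<Rightarrow> ('k::field, 'v::ab_group_add) tensor) \<Rightarrow> ('k, 'v) tensor \<Rightarrow> ('k, 'v) tensor" where
  "linear_extension g t = (\<lambda>B. t (\<lambda>w. g w B))"

definition bilinear_extension ::
  "('v list \<Rightarrow> 'v list \<Rightarrow> ('k::field, 'v::ab_group_add) tensor) \<Rightarrow>
     ('k, 'v) tensor \<Rightarrow> ('k, 'v) tensor \<Rightarrow> ('k, 'v) tensor" where
  "bilinear_extension m t t' = linear_extension (\<lambda>u. linear_extension (m u) t') t"

definition prepend ::
  "('k::field \<Rightarrow> 'v::ab_group_add \<Rightarrow> 'v) \<Rightarrow> 'v \<Rightarrow> ('k, 'v) tensor \<Rightarrow> ('k, 'v) tensor" where
  "prepend s x = linear_extension (\<lambda>w. word s (x # w))"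

fun shuffle_words ::
  "('k::field \<Rightarrow> 'v::ab_group_add \<Rightarrow> 'v) \<Rightarrow> 'v list \<Rightarrow> 'v list \<Rightarrow> ('k, 'v) tensor" where
  "shuffle_words s [] w = word s w"
| "shuffle_words s (x # u) [] = word s (x # u)"
| "shuffle_words s (x # u) (y # v) =
     prepend s x (shuffle_words s u (y # v)) + prepend s y (shuffle_words s (x # u) v)"

definition shuffle ::
  "('k::field \<Rightarrow> 'v::ab_group_add \<Rightarrow> 'v) \<Rightarrow> ('k, 'v) tensor \<Rightarrow> ('k, 'v) tensor \<Rightarrow> ('k, 'v) tensor" where
  "shuffle s = bilinear_extension (shuffle_words s)"

fun bullet_words ::
  "('k::field \<Rightarrow> 'v::ab_group_add \<Rightarrow> 'v) \<Rightarrow> ('v \<Rightarrow> 'v) \<Rightarrow> 'v list \<Rightarrow> 'v list \<Rightarrow> ('k, 'v) tensor" where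
  "bullet_words s f [] w' = 0"
| "bullet_words s f (x # w) w' =
     prepend s x (bullet_words s f w w') + prepend s (f x) (shuffle_words s w w')"

definition bullet ::
  "('k::field \<Rightarrow> 'v::ab_group_add \<Rightarrow> 'v) \<Rightarrow> ('v \<Rightarrow> 'v) \<Rightarrow>
     ('k, 'v) tensor \<Rightarrow> ('k, 'v) tensor \<Rightarrow> ('k, 'v) tensor" where
  "bullet s f = bilinear_extension (bullet_words s f)"

section \<open>The shifted gradation\<close>

text \<open>
  For \<open>is = [i\<^sub>1, \<dots>, i\<^sub>k]\<close> the following is the subspace \<open>V\<^bsub>i\<^sub>1\<^esub> \<otimes> \<dots> \<otimes> V\<^bsub>i\<^sub>k\<^esub>\<close>
  of \<open>T(V)\<close>; it is spanned by the empty word if \<open>k = 0\<close>.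
\<close>

definition tensor_component ::
  "('k::field \<Rightarrow> 'v::ab_group_add \<Rightarrow> 'v) \<Rightarrow> (nat \<Rightarrow> 'v set) \<Rightarrow> nat list \<Rightarrow> ('k, 'v) tensor set" where
  "tensor_component s V is =
     module.span tensor_scale (word s ` {xs. list_all2 (\<lambda>i x. x \<in> V i) is xs})"

text \<open>
  The condition \<open>i\<^sub>1 + \<dots> + i\<^sub>k = n - N\<close>, in which \<open>n - N\<close> is an integer, is written without
  subtraction.
\<close>

definition shifted_component ::
  "('k::field \<Rightarrow> 'v::ab_group_add \<Rightarrow> 'v) \<Rightarrow> (nat \<Rightarrow> 'v set) \<Rightarrow> nat \<Rightarrow> nat \<Rightarrow> ('k, 'v) tensor set" where
  "shifted_component s V N n =
     module.span tensor_scale (\<Union>is\<in>{is. sum_list is + N = n}. tensor_component s V is)"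

section \<open>Properties of the construction\<close>

interpretation tensor: vector_space "tensor_scale :: 'k::field \<Rightarrow> ('k, 'v) tensor \<Rightarrow> ('k, 'v) tensor"
  by unfold_locales (simp_all add: tensor_scale_def fun_eq_iff algebra_simps)

lemma tensor_scale_apply: "tensor_scale c t B = c * t B"
  by (simp add: tensor_scale_def)

lemma multilinearI:
  assumes "\<And>us x y vs. g (us @ (x + y) # vs) = g (us @ x # vs) + g (us @ y # vs)"
    and "\<And>us c x vs. g (us @ s c x # vs) = s' c (g (us @ x # vs))"
  shows "multilinear s s' g"
  using assms by (simp add: multilinear_def)

lemma multilinear_add_arg:
  "multilinear s s' g \<Longrightarrow> g (us @ (x + y) # vs) = g (us @ x # vs) + g (us @ y # vs)"
  by (simp add: multilinear_def)

lemma multilinear_scale_arg: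
  "multilinear s s' g \<Longrightarrow> g (us @ s c x # vs) = s' c (g (us @ x # vs))"
  by (simp add: multilinear_def)

lemma multilinear_zero: "multilinear s (*) (\<lambda>w. 0)"
  by (simp add: multilinear_def)

lemma multilinear_add:
  "multilinear s (*) g \<Longrightarrow> multilinear s (*) h \<Longrightarrow> multilinear s (*) (\<lambda>w. g w + h w)"
  by (simp add: multilinear_def algebra_simps)

lemma multilinear_mult: "multilinear s (*) g \<Longrightarrow> multilinear s (*) (\<lambda>w. c * g w)"
  by (simp add: multilinear_def algebra_simps)

lemma multilinear_tensor_iff:
  "multilinear s tensor_scale g \<longleftrightarrow> (\<forall>B. multilinear s (*) (\<lambda>w. g w B))"
  by (auto simp: multilinear_def tensor_scale_def fun_eq_iff)

lemma multilinear_Cons: "multilinear s s' B \<Longrightarrow> multilinear s s' (\<lambda>w. B (x # w))"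
  unfolding multilinear_def by (metis append_Cons)

lemma multilinear_word: "multilinear s tensor_scale (word s)"
  by (auto simp: multilinear_def tensor_scale_def word_def fun_eq_iff)

lemma multilinear_tensor_add:
  "multilinear s tensor_scale g \<Longrightarrow> multilinear s tensor_scale h \<Longrightarrow>
     multilinear s tensor_scale (\<lambda>w. g w + h w)"
  by (simp add: multilinear_tensor_iff multilinear_add)

lemma word_in_tensor_algebra [simp]: "word s w \<in> tensor_algebra s"
  by (simp add: tensor_algebra_def tensor.span_base)

lemma subspace_tensor_algebra: "tensor.subspace (tensor_algebra s)"
  by (simp add: tensor_algebra_def tensor.subspace_span)

lemma tensor_algebra_induct [consumes 1, case_names subspace word]:
  assumes "t \<in> tensor_algebra s" "tensor.subspace {t. P t}" "\<And>w. P (word s w)"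
  shows "P t"
  using tensor.span_induct[of t "range (word s)" P] assms by (auto simp: tensor_algebra_def)

lemma tensor_algebra_not_multilinear:
  assumes "t \<in> tensor_algebra s" "\<not> multilinear s (*) B"
  shows "t B = 0"
  using assms(1)
  by (induction rule: tensor_algebra_induct)
    (auto simp: tensor.subspace_def tensor_scale_def word_def assms(2))

lemma tensor_algebra_zero: "t \<in> tensor_algebra s \<Longrightarrow> t (\<lambda>w. 0) = 0"
  by (induction rule: tensor_algebra_induct)
    (auto simp: tensor.subspace_def tensor_scale_def word_def)

lemma tensor_algebra_add:
  assumes "t \<in> tensor_algebra s" "multilinear s (*) B" "multilinear s (*) C"
  shows "t (\<lambda>w. B w + C w) = t B + t C"
  using assms(1)
  by (induction rule: tensor_algebra_induct)
    (auto simp: tensor.subspace_def tensor_scale_def word_def assms multilinear_add algebra_simps)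

lemma tensor_algebra_mult:
  assumes "t \<in> tensor_algebra s" "multilinear s (*) B"
  shows "t (\<lambda>w. c * B w) = c * t B"
  using assms(1)
  by (induction rule: tensor_algebra_induct)
    (auto simp: tensor.subspace_def tensor_scale_def word_def assms multilinear_mult algebra_simps)

lemma linear_extension_word:
  "multilinear s tensor_scale g \<Longrightarrow> linear_extension g (word s w) = g w"
  by (simp add: linear_extension_def word_def multilinear_tensor_iff)

lemma linear_extension_zero [simp]: "linear_extension g 0 = 0"
  by (simp add: linear_extension_def fun_eq_iff)

lemma linear_extension_add: "linear_extension g (t + t') = linear_extension g t + linear_extension g t'"
  by (simp add: linear_extension_def fun_eq_iff)

lemma linear_extension_scale:
  "linear_extension g (tensor_scale c t) = tensor_scale c (linear_extension g t)"
  by (simp add: linear_extension_def tensor_scale_def)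

lemma linear_extension_in_subspace:
  assumes "t \<in> tensor_algebra s" "multilinear s tensor_scale g" "tensor.subspace S" "\<And>w. g w \<in> S"
  shows "linear_extension g t \<in> S"
  using assms(1) assms(3)
  by (induction rule: tensor_algebra_induct)
    (auto simp: tensor.subspace_def linear_extension_add linear_extension_scale
      linear_extension_word[OF assms(2)] assms(4))

lemma linear_extension_in_tensor_algebra:
  assumes "t \<in> tensor_algebra s" "multilinear s tensor_scale g" "\<And>w. g w \<in> tensor_algebra s"
  shows "linear_extension g t \<in> tensor_algebra s"
  using linear_extension_in_subspace[OF assms(1,2) subspace_tensor_algebra assms(3)] .

context
  notes plus_fun_apply [simp del] zero_fun_apply [simp del]
begin

lemma multilinear_word_Cons: "multilinear s tensor_scale (\<lambda>w. word s (x # w))"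
  by (rule multilinear_Cons[OF multilinear_word])

lemma prepend_word [simp]: "prepend s x (word s w) = word s (x # w)"
  by (simp add: prepend_def linear_extension_word multilinear_word_Cons)

lemma prepend_tensor_zero [simp]: "prepend s x 0 = 0"
  by (simp add: prepend_def)

lemma prepend_tensor_add: "prepend s x (t + t') = prepend s x t + prepend s x t'"
  by (simp add: prepend_def linear_extension_add)

lemma prepend_tensor_scale: "prepend s x (tensor_scale c t) = tensor_scale c (prepend s x t)"
  by (simp add: prepend_def linear_extension_scale)

lemma prepend_in_tensor_algebra [simp]: "t \<in> tensor_algebra s \<Longrightarrow> prepend s x t \<in> tensor_algebra s"
  by (simp add: prepend_def linear_extension_in_tensor_algebra multilinear_word_Cons)

lemma prepend_add:
  assumes "t \<in> tensor_algebra s"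
  shows "prepend s (x + y) t = prepend s x t + prepend s y t"
  using assms
proof (induction rule: tensor_algebra_induct)
  case subspace
  then show ?case
    by (auto simp: tensor.subspace_def prepend_tensor_add prepend_tensor_scale tensor.scale_right_distrib)
next
  case (word w)
  then show ?case
    using multilinear_add_arg[OF multilinear_word, of s "[]"] by simp
qed

lemma prepend_scale:
  assumes "t \<in> tensor_algebra s"
  shows "prepend s (s c x) t = tensor_scale c (prepend s x t)"
  using assms
proof (induction rule: tensor_algebra_induct)
  case subspace
  then show ?case
    by (auto simp: tensor.subspace_def prepend_tensor_add prepend_tensor_scale
        tensor.scale_right_distrib mult.commute)
next
  case (word w)
  then show ?case
    using multilinear_scale_arg[OF multilinear_word, of s "[]"] by simp
qed

subsection \<open>The two products on words\<close>

lemma shuffle_words_Nil2 [simp]: "shuffle_words s u [] = word s u"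
  by (cases u) auto

lemma shuffle_words_in_tensor_algebra [simp]: "shuffle_words s u v \<in> tensor_algebra s"
  by (induction s u v rule: shuffle_words.induct)
    (auto intro: tensor.subspace_add[OF subspace_tensor_algebra])

lemma shuffle_words_commute: "shuffle_words s u v = shuffle_words s v u"
  by (induction s u v rule: shuffle_words.induct) (auto simp: add.commute)

lemma shuffle_words_add1:
  "shuffle_words s (us @ (x + y) # vs) w = shuffle_words s (us @ x # vs) w + shuffle_words s (us @ y # vs) w"
proof (induction us arbitrary: w)
  case Nil
  show ?case
  proof (induction w)
    case Nil
    show ?case using multilinear_add_arg[OF multilinear_word, of s "[]" x y vs] by simp
  next
    case (Cons z w)
    then show ?case by (simp add: prepend_tensor_add prepend_add)
  qed
next
  case (Cons a us)
  note outer = Cons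
  show ?case
  proof (induction w)
    case Nil
    show ?case using multilinear_add_arg[OF multilinear_word, of s "a # us" x y vs] by simp
  next
    case (Cons z w)
    then show ?case by (simp add: prepend_tensor_add outer)
  qed
qed

lemma shuffle_words_scale1:
  "shuffle_words s (us @ s c x # vs) w = tensor_scale c (shuffle_words s (us @ x # vs) w)"
proof (induction us arbitrary: w)
  case Nil
  show ?case
  proof (induction w)
    case Nil
    show ?case using multilinear_scale_arg[OF multilinear_word, of s "[]" c x vs] by simp
  next
    case (Cons z w)
    then show ?case
      by (simp add: prepend_tensor_scale prepend_scale tensor.scale_right_distrib)
  qed
next
  case (Cons a us)
  note outer = Cons
  show ?case
  proof (induction w)
    case Nil
    show ?case using multilinear_scale_arg[OF multilinear_word, of s "a # us" c x vs] by simp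
  next
    case (Cons z w)
    then show ?case by (simp add: prepend_tensor_scale outer tensor.scale_right_distrib)
  qed
qed

lemma multilinear_shuffle_words1: "multilinear s tensor_scale (\<lambda>u. shuffle_words s u v)"
  by (rule multilinearI) (fact shuffle_words_add1 shuffle_words_scale1)+

lemma multilinear_shuffle_words2: "multilinear s tensor_scale (shuffle_words s u)"
proof -
  have "shuffle_words s u = (\<lambda>v. shuffle_words s v u)"
    by (rule ext) (rule shuffle_words_commute)
  then show ?thesis using multilinear_shuffle_words1[of s u] by simp
qed

lemma bullet_words_in_tensor_algebra [simp]: "bullet_words s f u v \<in> tensor_algebra s"
  by (induction u)
    (auto intro: tensor.subspace_add[OF subspace_tensor_algebra] tensor.subspace_0[OF subspace_tensor_algebra])

lemma multilinear_bullet_words2: "multilinear s tensor_scale (bullet_words s f u)"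
proof (induction u)
  case Nil
  show ?case by (simp add: multilinear_def)
next
  case (Cons x u)
  then show ?case
    using multilinear_shuffle_words2[of s u]
    by (simp add: multilinear_def prepend_tensor_add prepend_tensor_scale tensor.scale_right_distrib)
qed

lemma multilinear_bullet_words1:
  assumes "Vector_Spaces.linear s s f"
  shows "multilinear s tensor_scale (\<lambda>u. bullet_words s f u v)"
proof -
  interpret f: Vector_Spaces.linear s s f by fact
  show ?thesis
  proof (rule multilinearI)
    show "bullet_words s f (us @ (x + y) # vs) v =
        bullet_words s f (us @ x # vs) v + bullet_words s f (us @ y # vs) v" for us x y vs
      by (induction us)
        (simp_all add: f.add prepend_add prepend_tensor_add shuffle_words_add1)
    show "bullet_words s f (us @ s c x # vs) v = tensor_scale c (bullet_words s f (us @ x # vs) v)"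
      for us c x vs
      by (induction us)
        (simp_all add: f.scale prepend_scale prepend_tensor_scale shuffle_words_scale1
          tensor.scale_right_distrib)
  qed
qed

subsection \<open>The products are bilinear and satisfy the defining recursions\<close>

lemma bilinear_extension_word:
  assumes "\<And>v. multilinear s tensor_scale (\<lambda>u. m u v)" "\<And>u. multilinear s tensor_scale (m u)"
  shows "bilinear_extension m (word s u) (word s v) = m u v"
  using assms by (simp add: bilinear_extension_def linear_extension_word)

lemma bilinear_extension_zero1 [simp]: "bilinear_extension m 0 t = 0"
  by (simp add: bilinear_extension_def)

lemma bilinear_extension_add1:
  "bilinear_extension m (t1 + t2) t = bilinear_extension m t1 t + bilinear_extension m t2 t"
  by (simp add: bilinear_extension_def linear_extension_add)

lemma bilinear_extension_scale1:
  "bilinear_extension m (tensor_scale c t) t' = tensor_scale c (bilinear_extension m t t')"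
  by (simp add: bilinear_extension_def linear_extension_scale)

lemma multilinear_linear_extension:
  assumes "\<And>v. multilinear s tensor_scale (\<lambda>u. m u v)" "\<And>u. multilinear s tensor_scale (m u)"
    and "t \<in> tensor_algebra s"
  shows "multilinear s tensor_scale (\<lambda>u. linear_extension (m u) t)"
  using assms(3)
proof (induction rule: tensor_algebra_induct)
  case subspace
  show ?case
    by (auto simp: tensor.subspace_def multilinear_def linear_extension_add linear_extension_scale
        tensor.scale_right_distrib mult.commute)
next
  case (word w)
  show ?case using assms(1,2) by (simp add: linear_extension_word)
qed

lemma bilinear_extension_in_tensor_algebra:
  assumes "\<And>v. multilinear s tensor_scale (\<lambda>u. m u v)" "\<And>u. multilinear s tensor_scale (m u)"
    and "\<And>u v. m u v \<in> tensor_algebra s" "t \<in> tensor_algebra s" "t' \<in> tensor_algebra s"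
  shows "bilinear_extension m t t' \<in> tensor_algebra s"
  unfolding bilinear_extension_def
  by (intro linear_extension_in_tensor_algebra multilinear_linear_extension assms)

lemma bilinear_extension_zero2 [simp]:
  "t \<in> tensor_algebra s \<Longrightarrow> bilinear_extension m t 0 = 0"
  by (simp add: bilinear_extension_def linear_extension_def fun_eq_iff tensor_algebra_zero
      zero_fun_apply)

lemma bilinear_extension_add2:
  assumes "\<And>v. multilinear s tensor_scale (\<lambda>u. m u v)" "\<And>u. multilinear s tensor_scale (m u)"
    and "t \<in> tensor_algebra s" "t1 \<in> tensor_algebra s" "t2 \<in> tensor_algebra s"
  shows "bilinear_extension m t (t1 + t2) = bilinear_extension m t t1 + bilinear_extension m t t2"
proof
  fix B
  have "multilinear s (*) (\<lambda>u. t' (\<lambda>v. m u v B))" if "t' \<in> tensor_algebra s" for t'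
    using multilinear_linear_extension[OF assms(1,2) that]
    by (simp add: multilinear_tensor_iff linear_extension_def)
  then show "bilinear_extension m t (t1 + t2) B = (bilinear_extension m t t1 + bilinear_extension m t t2) B"
    using assms(3-)
    by (simp add: bilinear_extension_def linear_extension_def plus_fun_apply tensor_algebra_add[of t s])
qed

lemma bilinear_extension_scale2:
  assumes "\<And>v. multilinear s tensor_scale (\<lambda>u. m u v)" "\<And>u. multilinear s tensor_scale (m u)"
    and "t \<in> tensor_algebra s" "t' \<in> tensor_algebra s"
  shows "bilinear_extension m t (tensor_scale c t') = tensor_scale c (bilinear_extension m t t')"
proof
  fix B
  have "multilinear s (*) (\<lambda>u. t' (\<lambda>v. m u v B))"
    using multilinear_linear_extension[OF assms(1,2,4)]
    by (simp add: multilinear_tensor_iff linear_extension_def)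
  then show "bilinear_extension m t (tensor_scale c t') B = tensor_scale c (bilinear_extension m t t') B"
    using assms(3-)
    by (simp add: bilinear_extension_def linear_extension_def tensor_scale_def tensor_algebra_mult[of t s])
qed

lemma bilinear_eq_on_tensor_algebra:
  assumes "t \<in> tensor_algebra s" "t' \<in> tensor_algebra s"
    and "\<And>v. v \<in> tensor_algebra s \<Longrightarrow> tensor.subspace {u \<in> tensor_algebra s. P u v}"
    and "\<And>u. u \<in> tensor_algebra s \<Longrightarrow> tensor.subspace {v \<in> tensor_algebra s. P u v}"
    and "\<And>u v. P (word s u) (word s v)"
  shows "P t t'"
proof -
  have *: "tensor_algebra s \<subseteq> S" if "tensor.subspace S" "range (word s) \<subseteq> S" for S
    unfolding tensor_algebra_def by (rule tensor.span_minimal[OF that(2,1)])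
  have "tensor_algebra s \<subseteq> {v \<in> tensor_algebra s. P (word s u) v}" for u
    by (rule *) (auto intro: assms)
  then have "tensor_algebra s \<subseteq> {u \<in> tensor_algebra s. P u t'}"
    using assms(2) by (intro *) (auto intro: assms)
  then show ?thesis using assms(1) by blast
qed

lemmas shuffle_multilinear = multilinear_shuffle_words1 multilinear_shuffle_words2

lemma shuffle_word: "shuffle s (word s u) (word s v) = shuffle_words s u v"
  unfolding shuffle_def by (rule bilinear_extension_word[OF shuffle_multilinear])

lemma shuffle_closed [simp]:
  "t \<in> tensor_algebra s \<Longrightarrow> t' \<in> tensor_algebra s \<Longrightarrow> shuffle s t t' \<in> tensor_algebra s"
  unfolding shuffle_def
  by (rule bilinear_extension_in_tensor_algebra[OF shuffle_multilinear]) auto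

lemma shuffle_add1: "shuffle s (t1 + t2) t = shuffle s t1 t + shuffle s t2 t"
  by (simp add: shuffle_def bilinear_extension_add1)

lemma shuffle_scale1: "shuffle s (tensor_scale c t) t' = tensor_scale c (shuffle s t t')"
  by (simp add: shuffle_def bilinear_extension_scale1)

lemma shuffle_add2:
  "t \<in> tensor_algebra s \<Longrightarrow> t1 \<in> tensor_algebra s \<Longrightarrow> t2 \<in> tensor_algebra s \<Longrightarrow>
     shuffle s t (t1 + t2) = shuffle s t t1 + shuffle s t t2"
  unfolding shuffle_def by (rule bilinear_extension_add2[OF shuffle_multilinear])

lemma shuffle_scale2:
  "t \<in> tensor_algebra s \<Longrightarrow> t' \<in> tensor_algebra s \<Longrightarrow>
     shuffle s t (tensor_scale c t') = tensor_scale c (shuffle s t t')"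
  unfolding shuffle_def by (rule bilinear_extension_scale2[OF shuffle_multilinear])

lemma shuffle_zero [simp]: "shuffle s 0 t = 0" "t \<in> tensor_algebra s \<Longrightarrow> shuffle s t 0 = 0"
  by (simp_all add: shuffle_def)

theorem shuffle_Nil:
  assumes "t \<in> tensor_algebra s"
  shows "shuffle s (word s []) t = t" "shuffle s t (word s []) = t"
proof -
  have Z: "0 \<in> tensor_algebra s" and A: "\<And>u v. u \<in> tensor_algebra s \<Longrightarrow> v \<in> tensor_algebra s \<Longrightarrow> u + v \<in> tensor_algebra s"
    and S: "\<And>c u. u \<in> tensor_algebra s \<Longrightarrow> tensor_scale c u \<in> tensor_algebra s"
    using subspace_tensor_algebra[of s] by (auto simp: tensor.subspace_def)
  have "t \<in> tensor_algebra s \<and> shuffle s (word s []) t = t \<and> shuffle s t (word s []) = t"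
    using assms
    by (induction rule: tensor_algebra_induct)
      (auto simp: tensor.subspace_def Z A S shuffle_add1 shuffle_add2 shuffle_scale1 shuffle_scale2 shuffle_word)
  then show "shuffle s (word s []) t = t" "shuffle s t (word s []) = t" by auto
qed

theorem shuffle_prepend:
  assumes "u \<in> tensor_algebra s" "v \<in> tensor_algebra s"
  shows "shuffle s (prepend s x u) (prepend s y v) =
    prepend s x (shuffle s u (prepend s y v)) + prepend s y (shuffle s (prepend s x u) v)"
proof -
  have Z: "0 \<in> tensor_algebra s" and A: "\<And>u v. u \<in> tensor_algebra s \<Longrightarrow> v \<in> tensor_algebra s \<Longrightarrow> u + v \<in> tensor_algebra s"
    and S: "\<And>c u. u \<in> tensor_algebra s \<Longrightarrow> tensor_scale c u \<in> tensor_algebra s"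
    using subspace_tensor_algebra[of s] by (auto simp: tensor.subspace_def)
  show ?thesis
    by (rule bilinear_eq_on_tensor_algebra[OF assms])
      (auto simp: tensor.subspace_def Z A S shuffle_add1 shuffle_add2 shuffle_scale1 shuffle_scale2
        prepend_tensor_add prepend_tensor_scale tensor.scale_right_distrib shuffle_word)
qed

context
  fixes s :: "'k::field \<Rightarrow> 'v::ab_group_add \<Rightarrow> 'v" and f :: "'v \<Rightarrow> 'v"
  assumes linear_f: "Vector_Spaces.linear s s f"
begin

lemmas bullet_multilinear = multilinear_bullet_words1[OF linear_f] multilinear_bullet_words2

lemma bullet_word: "bullet s f (word s u) (word s v) = bullet_words s f u v"
  unfolding bullet_def by (rule bilinear_extension_word[OF bullet_multilinear])

lemma bullet_closed [simp]:
  "t \<in> tensor_algebra s \<Longrightarrow> t' \<in> tensor_algebra s \<Longrightarrow> bullet s f t t' \<in> tensor_algebra s"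
  unfolding bullet_def
  by (rule bilinear_extension_in_tensor_algebra[OF bullet_multilinear]) auto

lemma bullet_add1: "bullet s f (t1 + t2) t = bullet s f t1 t + bullet s f t2 t"
  by (simp add: bullet_def bilinear_extension_add1)

lemma bullet_scale1: "bullet s f (tensor_scale c t) t' = tensor_scale c (bullet s f t t')"
  by (simp add: bullet_def bilinear_extension_scale1)

lemma bullet_add2:
  "t \<in> tensor_algebra s \<Longrightarrow> t1 \<in> tensor_algebra s \<Longrightarrow> t2 \<in> tensor_algebra s \<Longrightarrow>
     bullet s f t (t1 + t2) = bullet s f t t1 + bullet s f t t2"
  unfolding bullet_def by (rule bilinear_extension_add2[OF bullet_multilinear])

lemma bullet_scale2:
  "t \<in> tensor_algebra s \<Longrightarrow> t' \<in> tensor_algebra s \<Longrightarrow>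
     bullet s f t (tensor_scale c t') = tensor_scale c (bullet s f t t')"
  unfolding bullet_def by (rule bilinear_extension_scale2[OF bullet_multilinear])

lemma bullet_zero [simp]: "bullet s f 0 t = 0" "t \<in> tensor_algebra s \<Longrightarrow> bullet s f t 0 = 0"
  by (simp_all add: bullet_def)

theorem bullet_Nil:
  assumes "t \<in> tensor_algebra s"
  shows "bullet s f (word s []) t = 0"
proof -
  have Z: "0 \<in> tensor_algebra s" and A: "\<And>u v. u \<in> tensor_algebra s \<Longrightarrow> v \<in> tensor_algebra s \<Longrightarrow> u + v \<in> tensor_algebra s"
    and S: "\<And>c u. u \<in> tensor_algebra s \<Longrightarrow> tensor_scale c u \<in> tensor_algebra s"
    using subspace_tensor_algebra[of s] by (auto simp: tensor.subspace_def)
  have "t \<in> tensor_algebra s \<and> bullet s f (word s []) t = 0"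
    using assms
    by (induction rule: tensor_algebra_induct)
      (auto simp: tensor.subspace_def Z A S bullet_add2 bullet_scale2 bullet_word)
  then show ?thesis by auto
qed

theorem bullet_prepend:
  assumes "w \<in> tensor_algebra s" "w' \<in> tensor_algebra s"
  shows "bullet s f (prepend s x w) w' = prepend s x (bullet s f w w') + prepend s (f x) (shuffle s w w')"
proof -
  have Z: "0 \<in> tensor_algebra s" and A: "\<And>u v. u \<in> tensor_algebra s \<Longrightarrow> v \<in> tensor_algebra s \<Longrightarrow> u + v \<in> tensor_algebra s"
    and S: "\<And>c u. u \<in> tensor_algebra s \<Longrightarrow> tensor_scale c u \<in> tensor_algebra s"
    using subspace_tensor_algebra[of s] by (auto simp: tensor.subspace_def)
  show ?thesis
    by (rule bilinear_eq_on_tensor_algebra[OF assms])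
      (auto simp: tensor.subspace_def Z A S bullet_add1 bullet_add2 bullet_scale1 bullet_scale2
        shuffle_add1 shuffle_add2 shuffle_scale1 shuffle_scale2
        prepend_tensor_add prepend_tensor_scale tensor.scale_right_distrib shuffle_word bullet_word)
qed

end

end

subsection \<open>The universal property and the grading by length\<close>

theorem tensor_algebra_universal:
  fixes s :: "'k::field \<Rightarrow> 'v::ab_group_add \<Rightarrow> 'v" and s' :: "'k \<Rightarrow> 'w::ab_group_add \<Rightarrow> 'w"
  assumes "vector_space s'" "multilinear s s' g"
  shows "\<exists>h. Vector_Spaces.linear tensor_scale s' h \<and> (\<forall>w. h (word s w) = g w)"
proof -
  interpret W: vector_space s' by fact
  interpret P: vector_space_pair "tensor_scale :: 'k \<Rightarrow> ('k, 'v) tensor \<Rightarrow> ('k, 'v) tensor" s' ..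
  interpret D: vector_space_pair s' "(*) :: 'k \<Rightarrow> 'k \<Rightarrow> 'k"
    by unfold_locales (simp_all add: algebra_simps)
  obtain B where B: "B \<subseteq> range (word s)" "tensor.independent B" "range (word s) \<subseteq> tensor.span B"
    using tensor.maximal_independent_subset[of "range (word s)"] by metis
  define c where "c = inv (word s)"
  have c: "word s (c b) = b" if "b \<in> B" for b
    using that B(1) unfolding c_def by (intro f_inv_into_f) blast
  obtain h where h: "Vector_Spaces.linear tensor_scale s' h" "\<And>b. b \<in> B \<Longrightarrow> h b = g (c b)"
    using P.linear_independent_extend[OF B(2), of "\<lambda>b. g (c b)"] by auto
  interpret h: Vector_Spaces.linear tensor_scale s' h by fact
  have "h (word s w) = g w" for w
  proof (rule ccontr)
    assume "h (word s w) \<noteq> g w"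
    then have "W.independent {h (word s w) - g w}" by simp
    then obtain l where l: "Vector_Spaces.linear s' (*) l" "l (h (word s w) - g w) = (1::'k)"
      using D.linear_independent_extend[of "{h (word s w) - g w}" "\<lambda>_. 1"] by auto
    interpret l: Vector_Spaces.linear s' "(*)" l by fact
    have ml: "multilinear s (*) (\<lambda>w. l (g w))"
      using assms(2) by (simp add: multilinear_def l.add l.scale)
    have "l (h t) = t (\<lambda>w. l (g w))" if "t \<in> tensor.span B" for t
      using that
    proof (induction rule: tensor.span_induct)
      case base
      show ?case
        by (auto simp: tensor.subspace_def h.add h.scale h.zero l.add l.scale l.zero tensor_scale_apply)
    next
      case (step b)
      then have "l (h b) = word s (c b) (\<lambda>w. l (g w))" using ml by (simp add: h(2) word_def)
      then show ?case using step c by simp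
    qed
    from this[of "word s w"] have "l (h (word s w)) = l (g w)"
      using B(3) ml by (auto simp: word_def)
    then show False using l(2) by (simp add: l.diff)
  qed
  then show ?thesis using h(1) by blast
qed

theorem tensor_algebra_universal_unique:
  assumes "Vector_Spaces.linear tensor_scale s' h" "Vector_Spaces.linear tensor_scale s' h'"
    and "\<And>w. h (word s w) = h' (word s w)" "t \<in> tensor_algebra s"
  shows "h t = h' t"
proof -
  interpret vector_space_pair tensor_scale s'
    using assms(1) by (intro vector_space_pair.intro tensor.vector_space_axioms) (rule Vector_Spaces.linear.axioms(2))
  have "x \<in> range (word s) \<Longrightarrow> h x = h' x" for x
    using assms(3) by blast
  from linear_eq_on_span[OF assms(1,2) this assms(4)[unfolded tensor_algebra_def]]
  show ?thesis .
qed

lemma direct_sum_decomposition_projections: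
  assumes "vector_space s" "module.subspace s W"
    and "\<And>n. module.subspace s (A n)" "\<And>n. A n \<subseteq> W"
    and p_zero: "\<And>n. p n 0 = 0" and p_add: "\<And>n x y. x \<in> W \<Longrightarrow> y \<in> W \<Longrightarrow> p n (x + y) = p n x + p n y"
    and p_A: "\<And>n m x. x \<in> A m \<Longrightarrow> p n x = (if n = m then x else 0)"
    and gen: "W \<subseteq> module.span s (\<Union>n. A n)"
  shows "direct_sum_decomposition s W A"
proof -
  interpret vector_space s by fact
  have p_sum: "p n (sum d I) = (\<Sum>i\<in>I. p n (d i))" if "finite I" "\<And>i. i \<in> I \<Longrightarrow> d i \<in> W" for n d and I :: "nat set"
    using that
    by (induction I rule: finite_induct) (auto simp: p_zero p_add subspace_sum[OF assms(2)])
  have ex: "\<exists>d. (\<forall>n. d n \<in> A n) \<and> finite {n. d n \<noteq> 0} \<and> v = (\<Sum>n | d n \<noteq> 0. d n)" if "v \<in> W" for v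
  proof -
    define Q where "Q v \<longleftrightarrow> (\<exists>d I. (\<forall>n. d n \<in> A n) \<and> finite I \<and> (\<forall>n. n \<notin> I \<longrightarrow> d n = 0) \<and> v = sum d I)" for v
    have "v \<in> span (\<Union>n. A n)" using gen that by auto
    then have "Q v"
    proof (induction rule: span_induct)
      case base
      show ?case unfolding subspace_def mem_Collect_eq
      proof (intro conjI allI ballI)
        show "Q 0" unfolding Q_def
          by (rule exI[of _ "\<lambda>_. 0"], rule exI[of _ "{}"]) (auto simp: subspace_0[OF assms(3)])
        fix x assume "x \<in> Collect Q"
        then obtain d I where d: "\<forall>n. d n \<in> A n" "finite I" "\<forall>n. n \<notin> I \<longrightarrow> d n = 0" "x = sum d I"
          unfolding Q_def by auto
        show "Q (s c x)" for c
          unfolding Q_def using d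
          by (intro exI[of _ "\<lambda>n. s c (d n)"] exI[of _ I]) (auto simp: subspace_scale[OF assms(3)] scale_sum_right)
        fix y assume "y \<in> Collect Q"
        then obtain e J where e: "\<forall>n. e n \<in> A n" "finite J" "\<forall>n. n \<notin> J \<longrightarrow> e n = 0" "y = sum e J"
          unfolding Q_def by auto
        have "sum d I = sum d (I \<union> J)" "sum e J = sum e (I \<union> J)"
          using d e by (auto intro!: sum.mono_neutral_left)
        then show "Q (x + y)"
          unfolding Q_def using d e
          by (intro exI[of _ "\<lambda>n. d n + e n"] exI[of _ "I \<union> J"]) (auto simp: subspace_add[OF assms(3)] sum.distrib)
      qed
    next
      case (step x)
      then obtain n where "x \<in> A n" by auto
      then show ?case unfolding Q_def
        by (intro exI[of _ "\<lambda>m. if m = n then x else 0"] exI[of _ "{n}"]) (auto simp: subspace_0[OF assms(3)])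
    qed
    then obtain d I where d: "\<forall>n. d n \<in> A n" "finite I" "\<forall>n. n \<notin> I \<longrightarrow> d n = 0" "v = sum d I"
      unfolding Q_def by auto
    then have "{n. d n \<noteq> 0} \<subseteq> I" by auto
    then have "finite {n. d n \<noteq> 0}" "sum d I = (\<Sum>n | d n \<noteq> 0. d n)"
      using d(2) by (auto intro: finite_subset sum.mono_neutral_right)
    then show ?thesis using d(1,4) by (intro exI[of _ d]) simp
  qed
  have uniq: "d n = p n v" if "\<forall>n. d n \<in> A n" "finite {n. d n \<noteq> 0}" "v = (\<Sum>n | d n \<noteq> 0. d n)" for d v n
  proof -
    have "p n v = (\<Sum>m | d m \<noteq> 0. p n (d m))"
      unfolding that(3) by (rule p_sum[OF that(2)]) (use that(1) assms(4) in blast)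
    also have "\<dots> = (\<Sum>m | d m \<noteq> 0. if n = m then d m else 0)"
      by (intro sum.cong refl p_A that(1)[rule_format])
    also have "\<dots> = d n" using that(2) by simp
    finally show ?thesis by (rule sym)
  qed
  have "\<exists>!d. (\<forall>n. d n \<in> A n) \<and> finite {n. d n \<noteq> 0} \<and> v = (\<Sum>n | d n \<noteq> 0. d n)" if "v \<in> W" for v
  proof (rule ex_ex1I[OF ex[OF that]])
    fix d e :: "nat \<Rightarrow> 'b"
    assume d: "(\<forall>n. d n \<in> A n) \<and> finite {n. d n \<noteq> 0} \<and> v = (\<Sum>n | d n \<noteq> 0. d n)"
      and e: "(\<forall>n. e n \<in> A n) \<and> finite {n. e n \<noteq> 0} \<and> v = (\<Sum>n | e n \<noteq> 0. e n)"
    have "d n = p n v" "e n = p n v" for n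
      using uniq[of d v n] uniq[of e v n] d e by blast+
    then show "d = e" by (simp add: fun_eq_iff)
  qed
  then have "\<forall>v\<in>W. \<exists>!d. (\<forall>n. d n \<in> A n) \<and> finite {n. d n \<noteq> 0} \<and> v = (\<Sum>n | d n \<noteq> 0. d n)"
    by (rule ballI)
  moreover have "\<forall>n. subspace (A n) \<and> A n \<subseteq> W"
    using assms(3,4) by (rule allI[OF conjI])
  ultimately show ?thesis
    unfolding direct_sum_decomposition_def using assms(2) by (intro conjI)
qed

theorem tensor_algebra_tensor_power:
  "direct_sum_decomposition tensor_scale (tensor_algebra s) (tensor_power s)"
proof -
  let ?p = "\<lambda>k t B. (t :: ('a, 'b) tensor) (\<lambda>w. if length w = k then B w else 0)"
  let ?q = "\<lambda>k t B. if multilinear s (*) B then ?p k t B else 0"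
  have ml: "multilinear s (*) (\<lambda>w. if length w = k then B w else 0)" if "multilinear s (*) B" for B k
    using that by (auto simp: multilinear_def)
  have q_word: "?q k (word s w) = (if k = length w then word s w else 0)" for k w
    using ml by (auto simp: word_def fun_eq_iff)
  have sub: "tensor_power s n \<subseteq> tensor_algebra s" for n
    unfolding tensor_power_def tensor_algebra_def by (rule tensor.span_mono) auto
  show ?thesis
  proof (rule direct_sum_decomposition_projections[where p = ?q])
    show "vector_space (tensor_scale :: 'a \<Rightarrow> ('a, 'b) tensor \<Rightarrow> _)" ..
    show "?q n x = (if n = m then x else 0)" if "x \<in> tensor_power s m" for n m x
      using that unfolding tensor_power_def
    proof (induction rule: tensor.span_induct)
      case base
      show ?case by (auto simp: tensor.subspace_def tensor_scale_def fun_eq_iff split: if_splits)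
    next
      case (step x)
      then show ?case using q_word by (auto simp: zero_fun_def)
    qed
    have "range (word s) \<subseteq> (\<Union>n. tensor_power s n)"
      by (auto simp: tensor_power_def intro!: tensor.span_base)
    then show "tensor_algebra s \<subseteq> tensor.span (\<Union>n. tensor_power s n)"
      unfolding tensor_algebra_def by (rule tensor.span_mono)
  qed (auto simp: subspace_tensor_algebra tensor_power_def tensor.subspace_span fun_eq_iff
      intro: sub[unfolded tensor_power_def, THEN subsetD])
qed

end

theory Submission
  imports Defs
begin

text \<open>
  Call \<open>d\<close> the weight of a word whose letters are homogeneous of degrees adding up to \<open>d\<close>. The
  component of index \<open>n\<close> is spanned by the words of weight \<open>d\<close> with \<open>d + N = n\<close>, so a product of
  elements of indices \<open>m\<close> and \<open>n\<close> has the right index exactly if the pre-Lie product raises the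
  total weight by \<open>N\<close>. It does: a shuffle permutes letters and preserves the total weight, and each
  word occurring in \<open>u \<bullet> v\<close> is a shuffle of \<open>u\<close> and \<open>v\<close> in which one letter of \<open>u\<close> has been replaced
  by its image under \<open>f\<close> (\<open>bullet_words_weight\<close>).

  For the direct sum, words of homogeneous letters span \<open>T(V)\<close> because every letter is a finite sum
  of homogeneous ones (\<open>shifted_components_generate\<close>). The sum is direct because there is a
  linear projection of \<open>T(V)\<close> onto each component: from the projections \<open>\<pi> i\<close> of \<open>V\<close> onto its homogeneous
  parts one forms the multilinear map
  \<open>x\<^sub>1 \<dots> x\<^sub>k \<mapsto> \<Sum> (\<pi> i\<^sub>1 x\<^sub>1) \<dots> (\<pi> i\<^sub>k x\<^sub>k)\<close>, the sum being over \<open>i\<^sub>1 + \<dots> + i\<^sub>k + N = n\<close>.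
  Extended linearly, it fixes the component of index \<open>n\<close> and kills the others
  (\<open>shifted_part_component\<close>).
\<close>

text \<open>Tensors are functions, but sums of them are not to be evaluated at arguments.\<close>

declare plus_fun_apply [simp del] zero_fun_apply [simp del]

section \<open>Projections of a direct sum\<close>

text \<open>
  Uniqueness of the decomposition of a vector makes its components depend linearly on it, since sums
  and multiples of decompositions are decompositions.
\<close>

lemma direct_sum_decomposition_obtain_projections:
  fixes s :: "'k::field \<Rightarrow> 'v::ab_group_add \<Rightarrow> 'v"
  assumes "vector_space s" "direct_sum_decomposition s UNIV A"
  obtains \<pi> where "\<And>n x y. \<pi> n (x + y) = \<pi> n x + \<pi> n y" "\<And>n c x. \<pi> n (s c x) = s c (\<pi> n x)"
    "\<And>n m x. x \<in> A m \<Longrightarrow> \<pi> n x = (if n = m then x else 0)"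
proof -
  interpret vector_space s by fact
  define decomp where "decomp d x \<longleftrightarrow> (\<forall>n. d n \<in> A n) \<and> finite {n. d n \<noteq> 0} \<and> x = (\<Sum>n | d n \<noteq> 0. d n)"
    for d x
  have A: "subspace (A n)" for n
    using assms(2) by (simp add: direct_sum_decomposition_def)
  have ex1: "\<exists>!d. decomp d x" for x
    using assms(2) unfolding direct_sum_decomposition_def decomp_def by blast
  define \<pi> where "\<pi> n x = (THE d. decomp d x) n" for n x
  have \<pi>: "decomp (\<lambda>n. \<pi> n x) x" for x
    using theI'[OF ex1] by (simp add: \<pi>_def)
  have uniq: "\<pi> n x = d n" if "decomp d x" for n x d
    using ex1 \<pi> that by metis
  have decompI: "decomp d x" if "\<And>n. d n \<in> A n" "finite I" "\<And>n. n \<notin> I \<Longrightarrow> d n = 0" "x = sum d I"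
    for d x and I :: "nat set"
  proof -
    have "{n. d n \<noteq> 0} \<subseteq> I" using that(3) by auto
    then show ?thesis
      using that unfolding decomp_def by (auto intro: finite_subset sum.mono_neutral_right)
  qed
  show thesis
  proof (rule that)
    fix n x y
    let ?I = "{n. \<pi> n x \<noteq> 0} \<union> {n. \<pi> n y \<noteq> 0}"
    have fin: "finite ?I" using \<pi> by (simp add: decomp_def)
    have "(\<Sum>n\<in>?I. \<pi> n z) = z" if "{n. \<pi> n z \<noteq> 0} \<subseteq> ?I" for z
    proof -
      have "(\<Sum>n\<in>?I. \<pi> n z) = (\<Sum>n | \<pi> n z \<noteq> 0. \<pi> n z)"
        using that by (intro sum.mono_neutral_right fin) auto
      then show ?thesis using \<pi>[of z] unfolding decomp_def by metis
    qed
    from this[of x] this[of y] have "(\<Sum>n\<in>?I. \<pi> n x) = x" "(\<Sum>n\<in>?I. \<pi> n y) = y"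
      by blast+
    then have "decomp (\<lambda>n. \<pi> n x + \<pi> n y) (x + y)"
      using fin \<pi> by (intro decompI[of _ ?I]) (auto simp: sum.distrib decomp_def intro: subspace_add[OF A])
    then show "\<pi> n (x + y) = \<pi> n x + \<pi> n y" by (rule uniq)
  next
    fix n c x
    have "(\<Sum>n | \<pi> n x \<noteq> 0. \<pi> n x) = x"
      using \<pi>[of x] unfolding decomp_def by metis
    then have "decomp (\<lambda>n. s c (\<pi> n x)) (s c x)"
      using \<pi> by (intro decompI[of _ "{n. \<pi> n x \<noteq> 0}"])
        (auto simp: decomp_def scale_sum_right[symmetric] intro: subspace_scale[OF A])
    then show "\<pi> n (s c x) = s c (\<pi> n x)" by (rule uniq)
  next
    fix n m x
    assume "x \<in> A m"
    then have "decomp (\<lambda>n. if n = m then x else 0) x"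
      by (intro decompI[of _ "{m}"]) (auto simp: subspace_0[OF A])
    then show "\<pi> n x = (if n = m then x else 0)" by (rule uniq)
  qed
qed

section \<open>Words of homogeneous letters\<close>

inductive homogeneous_word :: "(nat \<Rightarrow> 'v set) \<Rightarrow> nat \<Rightarrow> 'v list \<Rightarrow> bool" for V where
  Nil: "homogeneous_word V 0 []"
| Cons: "x \<in> V i \<Longrightarrow> homogeneous_word V d w \<Longrightarrow> homogeneous_word V (i + d) (x # w)"

lemma homogeneous_word_iff:
  "homogeneous_word V d w \<longleftrightarrow> (\<exists>is. sum_list is = d \<and> list_all2 (\<lambda>i x. x \<in> V i) is w)"
proof
  show "\<exists>is. sum_list is = d \<and> list_all2 (\<lambda>i x. x \<in> V i) is w" if "homogeneous_word V d w"
    using that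
  proof induction
    case (Cons x i d w)
    then obtain "is" where "sum_list is = d" "list_all2 (\<lambda>i x. x \<in> V i) is w" by blast
    then show ?case using Cons.hyps(1) by (intro exI[of _ "i # is"]) simp
  qed simp
next
  have "homogeneous_word V (sum_list is) w" if "list_all2 (\<lambda>i x. x \<in> V i) is w" for "is"
    using that by induction (auto intro: homogeneous_word.intros)
  then show "homogeneous_word V d w" if "\<exists>is. sum_list is = d \<and> list_all2 (\<lambda>i x. x \<in> V i) is w"
    using that by blast
qed

text \<open>
  The degrees of the letters are hidden in the weight and the nested spans become a single one, so
  that linear statements about a component need only be checked on words, by induction on them.
\<close>

lemma shifted_component_eq_span:
  "shifted_component s V N n = tensor.span (word s ` {w. \<exists>d. homogeneous_word V d w \<and> d + N = n})"
  (is "_ = tensor.span ?W")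
proof
  have "tensor_component s V is \<subseteq> tensor.span ?W" if "sum_list is + N = n" for "is"
    unfolding tensor_component_def
    by (rule tensor.span_mono) (use that in \<open>auto simp: homogeneous_word_iff\<close>)
  then show "shifted_component s V N n \<subseteq> tensor.span ?W"
    unfolding shifted_component_def by (intro tensor.span_minimal tensor.subspace_span) auto
  have "?W \<subseteq> (\<Union>is\<in>{is. sum_list is + N = n}. tensor_component s V is)"
    unfolding tensor_component_def homogeneous_word_iff by (blast intro: tensor.span_base)
  then show "tensor.span ?W \<subseteq> shifted_component s V N n"
    unfolding shifted_component_def by (rule tensor.span_mono)
qed

lemma subspace_shifted_component: "tensor.subspace (shifted_component s V N n)"
  by (simp add: shifted_component_def tensor.subspace_span)

lemma shifted_component_subset: "shifted_component s V N n \<subseteq> tensor_algebra s"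
  unfolding shifted_component_eq_span tensor_algebra_def by (rule tensor.span_mono) auto

lemma word_in_shifted_component:
  "homogeneous_word V d w \<Longrightarrow> word s w \<in> shifted_component s V N (d + N)"
  unfolding shifted_component_eq_span by (rule tensor.span_base) blast

lemma shifted_component_induct [consumes 1, case_names subspace word]:
  assumes "t \<in> shifted_component s V N n" "tensor.subspace {t. P t}"
    and "\<And>d w. homogeneous_word V d w \<Longrightarrow> n = d + N \<Longrightarrow> P (word s w)"
  shows "P t"
  using tensor.span_induct[of t _ P] assms unfolding shifted_component_eq_span by fast

lemma prepend_in_shifted_component:
  assumes "x \<in> V i" "t \<in> shifted_component s V N n"
  shows "prepend s x t \<in> shifted_component s V N (i + n)"
  using assms(2)
proof (induction rule: shifted_component_induct)
  case subspace
  show ?case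
    using subspace_shifted_component[of s V N "i + n"]
    by (auto simp: tensor.subspace_def prepend_tensor_add prepend_tensor_scale)
next
  case (word d w)
  then show ?case
    using word_in_shifted_component[OF homogeneous_word.Cons[of x V i d w], where s = s and N = N] assms(1)
    by (simp add: add.assoc)
qed

section \<open>The weight of the products\<close>

lemma shuffle_words_weight:
  assumes "homogeneous_word V d u" "homogeneous_word V e v"
  shows "shuffle_words s u v \<in> shifted_component s V N (d + e + N)"
  using assms
proof (induction s u v arbitrary: d e rule: shuffle_words.induct)
  case (1 s w)
  then show ?case
    by (auto elim!: homogeneous_word.cases[of _ _ "[]"] intro: word_in_shifted_component)
next
  case (2 s x u)
  then show ?case
    by (auto elim!: homogeneous_word.cases[of _ _ "[]"] intro: word_in_shifted_component)
next
  case (3 s x u y v)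
  from "3.prems"(1) obtain i d' where u: "x \<in> V i" "homogeneous_word V d' u" "d = i + d'"
    by (auto elim: homogeneous_word.cases)
  from "3.prems"(2) obtain j e' where v: "y \<in> V j" "homogeneous_word V e' v" "e = j + e'"
    by (auto elim: homogeneous_word.cases)
  have "prepend s x (shuffle_words s u (y # v)) \<in> shifted_component s V N (d + e + N)"
    using prepend_in_shifted_component[OF u(1) "3.IH"(1)[OF u(2) "3.prems"(2)]] u(3)
    by (simp add: ac_simps)
  moreover have "prepend s y (shuffle_words s (x # u) v) \<in> shifted_component s V N (d + e + N)"
    using prepend_in_shifted_component[OF v(1) "3.IH"(2)[OF "3.prems"(1) v(2)]] v(3)
    by (simp add: ac_simps)
  ultimately show ?case
    by (simp add: tensor.subspace_add[OF subspace_shifted_component])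
qed

text \<open>
  In the recursion for \<open>x u \<bullet> v\<close> the shift \<open>N\<close> is paid either inside \<open>u \<bullet> v\<close> or by the letter \<open>f x\<close>.
\<close>

lemma bullet_words_weight:
  assumes f: "\<And>n. f ` V n \<subseteq> V (n + N)"
    and "homogeneous_word V d u" "homogeneous_word V e v"
  shows "bullet_words s f u v \<in> shifted_component s V N ((d + N) + (e + N))"
  using assms(2)
proof induction
  case Nil
  show ?case by (simp add: tensor.subspace_0[OF subspace_shifted_component])
next
  case (Cons x i d w)
  have "f x \<in> V (i + N)" using f Cons.hyps(1) by blast
  from prepend_in_shifted_component[OF this shuffle_words_weight[OF Cons.hyps(2) assms(3)]]
  have "prepend s (f x) (shuffle_words s w v) \<in> shifted_component s V N ((i + d + N) + (e + N))"
    by (simp add: ac_simps)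
  moreover have "prepend s x (bullet_words s f w v) \<in> shifted_component s V N ((i + d + N) + (e + N))"
    using prepend_in_shifted_component[OF Cons.hyps(1) Cons.IH] by (simp add: ac_simps)
  ultimately show ?case
    by (simp add: tensor.subspace_add[OF subspace_shifted_component])
qed

lemma bullet_shifted_component:
  assumes lin: "Vector_Spaces.linear s s f" and f: "\<And>n. f ` V n \<subseteq> V (n + N)"
    and a: "a \<in> shifted_component s V N m" and b: "b \<in> shifted_component s V N n"
  shows "bullet s f a b \<in> shifted_component s V N (m + n)"
  using a
proof (induction rule: shifted_component_induct)
  case subspace
  show ?case
    using subspace_shifted_component[of s V N "m + n"]
    by (auto simp: tensor.subspace_def bullet_add1[OF lin] bullet_scale1[OF lin] bullet_zero[OF lin])
next
  case (word d u)
  \<comment> \<open>Additivity in the second factor is available inside \<open>T(V)\<close>, so membership is carried along.\<close>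
  have "b \<in> tensor_algebra s \<and> bullet s f (word s u) b \<in> shifted_component s V N (m + n)"
    using b
  proof (induction rule: shifted_component_induct)
    case subspace
    show ?case
      using subspace_shifted_component[of s V N "m + n"] subspace_tensor_algebra[of s]
      by (auto simp: tensor.subspace_def bullet_add2[OF lin] bullet_scale2[OF lin] bullet_zero[OF lin])
  next
    case (word e v)
    then show ?case
      using bullet_words_weight[where f = f, OF f \<open>homogeneous_word V d u\<close> word(1)] \<open>m = d + N\<close>
      by (simp add: bullet_word[OF lin])
  qed
  then show ?case by simp
qed

section \<open>The direct sum decomposition\<close>

lemma prepend_zero_letter:
  assumes "t \<in> tensor_algebra s"
  shows "prepend s 0 t = 0"
  using prepend_add[OF assms, of 0 0] by simp

text \<open>
  The span of all components is closed under prepending a homogeneous letter, hence, by additivity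
  in the letter, under prepending any letter. Starting from \<open>\<emptyset>\<close>, it therefore reaches all words.
\<close>

lemma shifted_components_generate:
  assumes V: "direct_sum_decomposition s UNIV V"
  shows "tensor_algebra s \<subseteq> tensor.span (\<Union>n. shifted_component s V N n)" (is "_ \<subseteq> ?H")
proof -
  have comp: "shifted_component s V N n \<subseteq> ?H" for n
    by (blast intro: tensor.span_base)
  have H: "?H \<subseteq> tensor_algebra s"
    by (rule tensor.span_minimal) (use shifted_component_subset subspace_tensor_algebra in blast)+
  have homogeneous: "prepend s x t \<in> ?H" if "t \<in> ?H" "x \<in> V i" for t x i
    using that(1)
  proof (induction rule: tensor.span_induct)
    case base
    show ?case
      using tensor.subspace_span[of "\<Union>n. shifted_component s V N n"]
      by (auto simp: tensor.subspace_def prepend_tensor_add prepend_tensor_scale)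
  next
    case (step t)
    then show ?case using prepend_in_shifted_component[where x = x and i = i and V = V, OF that(2)] comp by blast
  qed
  have prepend: "prepend s x t \<in> ?H" if t: "t \<in> ?H" for x t
  proof -
    obtain d where d: "\<And>n. d n \<in> V n" "finite {n. d n \<noteq> 0}" "x = (\<Sum>n | d n \<noteq> 0. d n)"
      using V unfolding direct_sum_decomposition_def by blast
    have "prepend s (sum d I) t \<in> ?H" if "finite I" for I
      using that
    proof induction
      case empty
      show ?case using prepend_zero_letter[of t s] t H by (auto simp: tensor.span_zero)
    next
      case (insert i I)
      then show ?case
        using t H homogeneous[OF t d(1)] by (auto simp: prepend_add tensor.span_add)
    qed
    then show ?thesis using d by simp
  qed
  have "word s w \<in> ?H" for w
  proof (induction w)
    case Nil
    show ?case using word_in_shifted_component[OF homogeneous_word.Nil] comp by blast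
  next
    case (Cons x w)
    then show ?case using prepend[of "word s w" x] by simp
  qed
  then show ?thesis
    unfolding tensor_algebra_def by (intro tensor.span_minimal tensor.subspace_span) auto
qed

text \<open>
  The sum of the words \<open>(\<pi> i\<^sub>1 x\<^sub>1) \<dots> (\<pi> i\<^sub>k x\<^sub>k)\<close> over \<open>i\<^sub>1 + \<dots> + i\<^sub>k + N = n\<close>, arranged by the
  value of \<open>i\<^sub>1\<close>. The bound \<open>i \<le> n\<close> keeps the subtraction \<open>n - i\<close> from being truncated.
\<close>

fun shifted_part ::
  "('k::field \<Rightarrow> 'v::ab_group_add \<Rightarrow> 'v) \<Rightarrow> (nat \<Rightarrow> 'v \<Rightarrow> 'v) \<Rightarrow> nat \<Rightarrow> nat \<Rightarrow> 'v list \<Rightarrow> ('k, 'v) tensor" where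
  "shifted_part s \<pi> N n [] = (if n = N then word s [] else 0)"
| "shifted_part s \<pi> N n (x # w) = (\<Sum>i\<le>n. prepend s (\<pi> i x) (shifted_part s \<pi> N (n - i) w))"

lemma shifted_part_in_tensor_algebra [simp]: "shifted_part s \<pi> N n w \<in> tensor_algebra s"
  by (induction w arbitrary: n)
    (auto intro: tensor.subspace_sum[OF subspace_tensor_algebra] tensor.subspace_0[OF subspace_tensor_algebra])

lemma multilinear_shifted_part:
  assumes "\<And>n x y. \<pi> n (x + y) = \<pi> n x + \<pi> n y" "\<And>n c x. \<pi> n (s c x) = s c (\<pi> n x)"
  shows "multilinear s tensor_scale (shifted_part s \<pi> N n)"
proof (rule multilinearI)
  show "shifted_part s \<pi> N n (us @ (x + y) # vs) =
      shifted_part s \<pi> N n (us @ x # vs) + shifted_part s \<pi> N n (us @ y # vs)" for us x y vs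
    by (induction us arbitrary: n)
      (simp_all add: assms prepend_add prepend_tensor_add sum.distrib)
  show "shifted_part s \<pi> N n (us @ s c x # vs) = tensor_scale c (shifted_part s \<pi> N n (us @ x # vs))"
    for us c x vs
    by (induction us arbitrary: n)
      (simp_all add: assms prepend_scale prepend_tensor_scale tensor.scale_sum_right)
qed

text \<open>
  On a word of homogeneous letters only the summand survives in which each \<open>i\<^sub>j\<close> is the degree of
  the \<open>j\<close>-th letter, and this summand is present only for one value of \<open>n\<close>.
\<close>

lemma shifted_part_homogeneous_word:
  assumes "\<And>n m x. x \<in> V m \<Longrightarrow> \<pi> n x = (if n = m then x else 0)"
    and "homogeneous_word V d w"
  shows "shifted_part s \<pi> N n w = (if n = d + N then word s w else 0)"
  using assms(2)
proof (induction arbitrary: n)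
  case Nil
  show ?case by simp
next
  case (Cons x i d w)
  have "prepend s (\<pi> j x) (shifted_part s \<pi> N (n - j) w) =
      (if j = i then prepend s x (shifted_part s \<pi> N (n - i) w) else 0)" for j
    by (simp add: assms(1)[OF Cons.hyps(1)] prepend_zero_letter)
  then have "shifted_part s \<pi> N n (x # w) =
      (if i \<le> n then prepend s x (shifted_part s \<pi> N (n - i) w) else 0)"
    by simp
  then show ?case by (auto simp: Cons.IH)
qed

lemma shifted_part_component:
  assumes lin: "\<And>n x y. \<pi> n (x + y) = \<pi> n x + \<pi> n y" "\<And>n c x. \<pi> n (s c x) = s c (\<pi> n x)"
    and proj: "\<And>n m x. x \<in> V m \<Longrightarrow> \<pi> n x = (if n = m then x else 0)"
    and t: "t \<in> shifted_component s V N m"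
  shows "linear_extension (shifted_part s \<pi> N n) t = (if n = m then t else 0)"
  using t
proof (induction rule: shifted_component_induct)
  case subspace
  show ?case
    by (auto simp: tensor.subspace_def linear_extension_add linear_extension_scale)
next
  case (word d w)
  then show ?case
    by (simp add: linear_extension_word[OF multilinear_shifted_part] lin
        shifted_part_homogeneous_word[OF proj])
qed

lemma direct_sum_shifted_component:
  assumes "vector_space s" "direct_sum_decomposition s UNIV V"
  shows "direct_sum_decomposition tensor_scale (tensor_algebra s) (shifted_component s V N)"
proof -
  obtain \<pi> where \<pi>: "\<And>n x y. \<pi> n (x + y) = \<pi> n x + \<pi> n y" "\<And>n c x. \<pi> n (s c x) = s c (\<pi> n x)"
    "\<And>n m x. x \<in> V m \<Longrightarrow> \<pi> n x = (if n = m then x else 0)"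
    using direct_sum_decomposition_obtain_projections[OF assms] by metis
  show ?thesis
  proof (rule direct_sum_decomposition_projections[where p = "\<lambda>n. linear_extension (shifted_part s \<pi> N n)"])
    show "linear_extension (shifted_part s \<pi> N n) t = (if n = m then t else 0)"
      if "t \<in> shifted_component s V N m" for n m t
      using shifted_part_component[OF \<pi> that] .
    show "tensor_algebra s \<subseteq> tensor.span (\<Union>n. shifted_component s V N n)"
      by (rule shifted_components_generate[OF assms(2)])
  qed (rule tensor.vector_space_axioms subspace_tensor_algebra subspace_shifted_component
      shifted_component_subset linear_extension_zero linear_extension_add)+
qed

theorem proposition10:
  fixes s :: "'k::field_char_0 \<Rightarrow> 'v::ab_group_add \<Rightarrow> 'v"
    and V :: "nat \<Rightarrow> 'v set"
    and f :: "'v \<Rightarrow> 'v"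
    and N :: nat
  assumes "vector_space s"
    and "direct_sum_decomposition s UNIV V"
    and "Vector_Spaces.linear s s f"
    and "\<And>n. f ` V n \<subseteq> V (n + N)"
  shows "direct_sum_decomposition tensor_scale (tensor_algebra s) (shifted_component s V N) \<and>
    (\<forall>m n. \<forall>a \<in> shifted_component s V N m. \<forall>b \<in> shifted_component s V N n.
      bullet s f a b \<in> shifted_component s V N (m + n))"
  using direct_sum_shifted_component[OF assms(1,2)] bullet_shifted_component[where V = V and N = N, OF assms(3,4)]
  by blast

end
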